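(* $[0,0,0,2]=4$. More precisely: let $n\ge 3$ and let $r,r_1,g,g_1$ be two (distinct) red vertices $r,r_1$ and two (distinct) green vertices $g,g_1$ in $\mathcal{Q}_n$. If $n\ge 4$, then there exists a $2$-path covering of $\mathcal{Q}_n$ with one path connecting $r$ to $r_1$ and the other connecting $g$ to $g_1$. If $n=3$, the same conclusion holds provided that $r$ and $r_1$ are contained in a two-dimensional subcube $\alpha$ of $\mathcal{Q}_3$ and exactly one of the vertices $g$ or $g_1$ is contained in $\alpha$.
   Context: $\mathcal{Q}_n$ is the $n$-dimensional binary hypercube: its vertices are all binary sequences of length $n$, adjacent iff they differ in exactly one position. A vertex is even or odd according to the parity of its number of 1's; vertices of one parity are called red and those of the other parity green. A path covering of a graph is a set of vertex-disjoint paths that cover all vertices of the graph; a $k$-path covering is a path covering by exactly $k$ paths. A fault $\mathcal{F}$ in $\mathcal{Q}_n$ is a set of deleted vertices; its mass is $|\mathcal{F}|$ and its charge is $|r(\mathcal{F})-g(\mathcal{F})|$, where $r(\mathcal{F})$, $g(\mathcal{F})$ are the numbers of red and green vertices in $\mathcal{F}$. $\mathcal{Q}_n-\mathcal{F}$ is the subgraph induced by the non-deleted vertices. A pair of vertices (or a path, via its two endpoints) is neutral if the two vertices have opposite parity and charged if they have the same parity; a charged pair is red (green) if its elements are red (green). A set $\mathcal{E}$ of disjoint pairs of vertices is in balance with $\mathcal{F}$ if all vertices in the pairs lie in $\mathcal{Q}_n-\mathcal{F}$ and $r(\mathcal{F})-g(\mathcal{F})=g(\mathcal{E})-r(\mathcal{E})$,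 where $r(\mathcal{E})$, $g(\mathcal{E})$ are the numbers of red and green pairs in $\mathcal{E}$. For a fault $\mathcal{F}$ of mass $M$ and charge $C$ in $\mathcal{Q}_n$, one can freely prescribe ends for a path covering of $\mathcal{Q}_n-\mathcal{F}$ with $N$ neutral paths and $O$ charged paths if (i) there is at least one set $\mathcal{E}$ of disjoint pairs of vertices in balance with $\mathcal{F}$ containing exactly $N$ neutral and $O$ charged pairs, and (ii) for every such $\mathcal{E}$ there is a path covering of $\mathcal{Q}_n-\mathcal{F}$ whose set of pairs of end vertices is $\mathcal{E}$. For nonnegative integers $M,C,N,O$, $\mathcal{A}_{M,C,N,O}$ is the set of nonnegative integers $m$ such that $m\ge\log_2[M+C+2N+2O]$ and for every $n\ge m$ and every fault $\mathcal{F}$ of mass $M$ and charge $C$ in $\mathcal{Q}_n$ one can freely prescribe ends for a path covering of $\mathcal{Q}_n-\mathcal{F}$ with $N$ neutral and $O$ charged paths. $[M,C,N,O]$ is the smallest element of $\mathcal{A}_{M,C,N,O}$ if this set is nonempty. *)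

theory Defs
  imports Complex_Main "Graph_Theory.Graph_Theory"
begin

definition hypercube :: "nat \<Rightarrow> bool list pair_pre_digraph" where
  "hypercube n = \<lparr>
     pverts = {v. length v = n},
     parcs = {(u, v). length u = n \<and> length v = n \<and> (\<exists>!i. i < n \<and> u ! i \<noteq> v ! i)} \<rparr>"

lemma pair_graph_hypercube: "pair_graph (hypercube n)"
proof -
  have fin: "finite {v :: bool list. length v = n}"
    using finite_lists_length_eq[of "UNIV :: bool set" n] by simp
  show ?thesis
  proof
    show "finite (pverts (hypercube n))"
      using fin by (simp add: hypercube_def)
    have "parcs (hypercube n) \<subseteq> {v. length v = n} \<times> {v. length v = n}"
      by (auto simp: hypercube_def)
    then show "finite (parcs (hypercube n))"
      using fin by (meson finite_SigmaI finite_subset)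
    have swap: "(v, u) \<in> parcs (hypercube n)" if "(u, v) \<in> parcs (hypercube n)" for u v
    proof -
      have "(\<lambda>i. i < n \<and> u ! i \<noteq> v ! i) = (\<lambda>i. i < n \<and> v ! i \<noteq> u ! i)"
        by (intro ext) blast
      with that show ?thesis
        by (simp add: hypercube_def)
    qed
    show "symmetric (with_proj (hypercube n))"
      unfolding symmetric_def with_proj_simps by (rule symI) (rule swap)
    show "fst e \<noteq> snd e" if "e \<in> parcs (hypercube n)" for e
    proof
      assume "fst e = snd e"
      moreover have "\<exists>i. i < n \<and> fst e ! i \<noteq> snd e ! i"
        using that by (simp add: hypercube_def split_beta) blast
      ultimately show False
        by simp
    qed
  qed (simp_all add: hypercube_def split_beta)
qed

text \<open>
  Which parity is called red is a free choice. The parameter \<open>odd_red\<close> records it: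
  the red vertices are the odd ones if it is true and the even ones otherwise.
\<close>

definition red :: "bool \<Rightarrow> bool list \<Rightarrow> bool" where
  "red odd_red v \<longleftrightarrow> (odd (count_list v True) \<longleftrightarrow> odd_red)"

abbreviation green :: "bool \<Rightarrow> bool list \<Rightarrow> bool" where
  "green odd_red v \<equiv> \<not> red odd_red v"

text \<open>
  Paths are non-empty lists of distinct vertices, so one path with more than one vertex is
  represented by two lists, each the reverse of the other. A covering cannot contain both of
  them, because distinct members have disjoint vertex sets.
\<close>

definition path_covering :: "('a, 'b) pre_digraph \<Rightarrow> 'a list set \<Rightarrow> bool" where
  "path_covering G P \<longleftrightarrow>
     (\<forall>p\<in>P. vpath p G) \<and>
     (\<forall>p\<in>P. \<forall>q\<in>P. p \<noteq> q \<longrightarrow> set p \<inter> set q = {}) \<and>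
     (\<Union>p\<in>P. set p) = verts G"

definition k_path_covering :: "nat \<Rightarrow> ('a, 'b) pre_digraph \<Rightarrow> 'a list set \<Rightarrow> bool" where
  "k_path_covering k G P \<longleftrightarrow> path_covering G P \<and> finite P \<and> card P = k"

definition end_pairs :: "'a list set \<Rightarrow> 'a set set" where
  "end_pairs P = (\<lambda>p. {hd p, last p}) ` P"

definition fault :: "nat \<Rightarrow> bool list set \<Rightarrow> bool" where
  "fault n F \<longleftrightarrow> F \<subseteq> verts (hypercube n)"

definition faulty_hypercube :: "nat \<Rightarrow> bool list set \<Rightarrow> (bool list, bool list \<times> bool list) pre_digraph" where
  "faulty_hypercube n F = with_proj (hypercube n) \<restriction> (verts (hypercube n) - F)"

text \<open>Number of red vertices minus number of green vertices.\<close>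

definition vertex_excess :: "bool \<Rightarrow> bool list set \<Rightarrow> int" where
  "vertex_excess odd_red F =
     int (card {v \<in> F. red odd_red v}) - int (card {v \<in> F. green odd_red v})"

definition charge :: "bool \<Rightarrow> bool list set \<Rightarrow> nat" where
  "charge odd_red F = nat \<bar>vertex_excess odd_red F\<bar>"

text \<open>A pair is a set with exactly two elements.\<close>

definition disjoint_pairs :: "'a set set \<Rightarrow> bool" where
  "disjoint_pairs E \<longleftrightarrow> (\<forall>e\<in>E. card e = 2) \<and> (\<forall>e\<in>E. \<forall>e'\<in>E. e \<noteq> e' \<longrightarrow> e \<inter> e' = {})"

definition red_pair :: "bool \<Rightarrow> bool list set \<Rightarrow> bool" where
  "red_pair odd_red e \<longleftrightarrow> (\<forall>v\<in>e. red odd_red v)"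

definition green_pair :: "bool \<Rightarrow> bool list set \<Rightarrow> bool" where
  "green_pair odd_red e \<longleftrightarrow> (\<forall>v\<in>e. green odd_red v)"

definition charged_pair :: "bool \<Rightarrow> bool list set \<Rightarrow> bool" where
  "charged_pair odd_red e \<longleftrightarrow> red_pair odd_red e \<or> green_pair odd_red e"

definition neutral_pair :: "bool \<Rightarrow> bool list set \<Rightarrow> bool" where
  "neutral_pair odd_red e \<longleftrightarrow> (\<exists>u\<in>e. \<exists>v\<in>e. red odd_red u \<and> green odd_red v)"

definition in_balance :: "bool \<Rightarrow> nat \<Rightarrow> bool list set \<Rightarrow> bool list set set \<Rightarrow> bool" where
  "in_balance odd_red n F E \<longleftrightarrow>
     disjoint_pairs E \<and>
     \<Union>E \<subseteq> verts (faulty_hypercube n F) \<and>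
     vertex_excess odd_red F =
       int (card {e \<in> E. green_pair odd_red e}) - int (card {e \<in> E. red_pair odd_red e})"

definition balanced_pair_sets ::
  "bool \<Rightarrow> nat \<Rightarrow> bool list set \<Rightarrow> nat \<Rightarrow> nat \<Rightarrow> bool list set set set" where
  "balanced_pair_sets odd_red n F N K =
     {E. in_balance odd_red n F E \<and>
         card {e \<in> E. neutral_pair odd_red e} = N \<and>
         card {e \<in> E. charged_pair odd_red e} = K}"

definition freely_prescribable ::
  "bool \<Rightarrow> nat \<Rightarrow> bool list set \<Rightarrow> nat \<Rightarrow> nat \<Rightarrow> bool" where
  "freely_prescribable odd_red n F N K \<longleftrightarrow>
     balanced_pair_sets odd_red n F N K \<noteq> {} \<and>
     (\<forall>E \<in> balanced_pair_sets odd_red n F N K.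
        \<exists>P. path_covering (faulty_hypercube n F) P \<and> end_pairs P = E)"

text \<open>
  For \<open>M = C = N = K = 0\<close> the logarithm is \<open>log 2 0\<close>, which is \<open>0\<close> here; like the usual
  \<open>- \<infinity>\<close>, this imposes no condition on \<open>m\<close>.
\<close>

definition prescribable_dims :: "bool \<Rightarrow> nat \<Rightarrow> nat \<Rightarrow> nat \<Rightarrow> nat \<Rightarrow> nat set" where
  "prescribable_dims odd_red M C N K =
     {m. real m \<ge> log 2 (real (M + C + 2 * N + 2 * K)) \<and>
         (\<forall>n\<ge>m. \<forall>F. fault n F \<and> card F = M \<and> charge odd_red F = C \<longrightarrow>
            freely_prescribable odd_red n F N K)}"

text \<open>
  The number written \<open>[M, C, N, K]\<close>. It is meaningful only if
  \<open>prescribable_dims odd_red M C N K\<close> is non-empty.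
\<close>

definition min_dim :: "bool \<Rightarrow> nat \<Rightarrow> nat \<Rightarrow> nat \<Rightarrow> nat \<Rightarrow> nat" where
  "min_dim odd_red M C N K = (LEAST m. m \<in> prescribable_dims odd_red M C N K)"

text \<open>A subcube is given by its vertex set: the positions outside \<open>D\<close> are fixed as in \<open>w\<close>.\<close>

definition subcube :: "nat \<Rightarrow> nat \<Rightarrow> bool list set \<Rightarrow> bool" where
  "subcube n k \<alpha> \<longleftrightarrow>
     (\<exists>D w. D \<subseteq> {..<n} \<and> card D = k \<and> w \<in> verts (hypercube n) \<and>
        \<alpha> = {v \<in> verts (hypercube n). \<forall>i\<in>{..<n} - D. v ! i = w ! i})"

end

theory Submission
  imports Defs
begin

text \<open>
  Everything is done by cutting a face of the cube into two halves along a free coordinate and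
  gluing paths of the halves along edges of the cut direction. Three covering results of this kind
  carry the proof. A face has a Hamiltonian path between any two vertices of opposite parity
  (\<open>traversable_face\<close>). After deletion of one vertex it still has one between any two distinct
  vertices of the other parity (\<open>traversable_face_minus_vertex\<close>). And it is covered by two paths
  with prescribed disjoint neutral pairs of ends (\<open>two_neutral_paths_face\<close>).

  For two charged paths, from \<open>r\<close> to \<open>r1\<close> and from \<open>g\<close> to \<open>g1\<close>, cut along a coordinate that
  separates \<open>r\<close> from \<open>r1\<close>. If \<open>g\<close> and \<open>g1\<close> lie in the same half, say in that of \<open>r\<close>, then that half
  without \<open>r\<close> is traversed from \<open>g\<close> to \<open>g1\<close>, while the other path steps from \<open>r\<close> across the cut and
  traverses the other half. This works in dimension three already, and with the colours exchanged
  it is exactly the situation singled out there: cut off the square \<open>\<alpha>\<close>.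

  If the cut separates \<open>g\<close> from \<open>g1\<close> as well, say with \<open>r\<close> and \<open>g\<close> in the same half, cover this half
  by a path from \<open>r\<close> to some \<open>x\<close> and a path from \<open>g\<close> to some \<open>y\<close>, both charged or trivial, cross the
  cut at \<open>x\<close> and \<open>y\<close>, and finish with two neutral paths in the other half. The only danger is that
  one path crosses the cut onto the end of the other one, and dimension three of the halves leaves
  enough room to choose \<open>x\<close> and \<open>y\<close> so as to avoid this.

  In dimension three the conclusion fails for two diagonals of the same square: the remaining
  neighbours force each of the two paths to use the opposite square in an impossible way.
\<close>

section \<open>Faces of the cube\<close>

abbreviation odd_vertex :: "bool list \<Rightarrow> bool" where
  "odd_vertex v \<equiv> odd (count_list v True)"

definition flip :: "nat \<Rightarrow> bool list \<Rightarrow> bool list" where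
  "flip i v = v[i := \<not> v ! i]"

definition adj :: "bool list \<Rightarrow> bool list \<Rightarrow> bool" where
  "adj u v \<longleftrightarrow> (\<exists>i < length u. v = flip i u)"

text \<open>
  A face is named by its free coordinates and any one of its vertices. Since every vertex of the
  face serves equally well (\<open>face_eq\<close>), halving a face never requires a change of coordinates.
\<close>

definition face :: "nat set \<Rightarrow> bool list \<Rightarrow> bool list set" where
  "face D v = {u. length u = length v \<and> (\<forall>i < length v. i \<notin> D \<longrightarrow> u ! i = v ! i)}"

lemma length_flip [simp]: "length (flip i v) = length v"
  by (simp add: flip_def)

lemma nth_flip: "j < length v \<Longrightarrow> flip i v ! j = (if i = j then \<not> v ! j else v ! j)"
  by (simp add: flip_def)

lemma flip_flip [simp]: "flip i (flip i v) = v"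
  by (cases "i < length v") (auto simp: flip_def list_update_beyond)

lemma odd_vertex_update:
  "i < length v \<Longrightarrow> odd_vertex (v[i := \<not> v ! i]) \<longleftrightarrow> \<not> odd_vertex v"
proof (induction v arbitrary: i)
  case (Cons a v)
  then show ?case by (cases i) auto
qed simp

lemma odd_vertex_flip [simp]: "i < length v \<Longrightarrow> odd_vertex (flip i v) \<longleftrightarrow> \<not> odd_vertex v"
  unfolding flip_def by (rule odd_vertex_update)

lemma adj_flip: "i < length v \<Longrightarrow> adj v (flip i v)"
  by (auto simp: adj_def)

lemma adj_sym: "adj u v \<Longrightarrow> adj v u"
  by (metis adj_def flip_flip length_flip)

lemma self_in_face [simp]: "v \<in> face D v"
  by (simp add: face_def)

lemma face_empty [simp]: "face {} v = {v}"
  by (auto simp: face_def list_eq_iff_nth_eq)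

lemma length_face: "u \<in> face D v \<Longrightarrow> length u = length v"
  by (simp add: face_def)

lemma face_eq: "u \<in> face D v \<Longrightarrow> face D u = face D v"
  by (auto simp: face_def)

lemma flip_in_face: "i \<in> D \<Longrightarrow> u \<in> face D v \<Longrightarrow> flip i u \<in> face D v"
  by (auto simp: face_def nth_flip)

lemma half_in_face: "u \<in> face (D - {i}) v \<Longrightarrow> u \<in> face D v"
  by (auto simp: face_def)

lemma in_half:
  "i \<in> D \<Longrightarrow> u \<in> face D v \<Longrightarrow> u ! i = v ! i \<Longrightarrow> u \<in> face (D - {i}) v"
  by (auto simp: face_def)

lemma half_nth: "u \<in> face (D - {i}) v \<Longrightarrow> i < length v \<Longrightarrow> u ! i = v ! i"
  by (auto simp: face_def)

lemma flip_in_half: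
  assumes "i \<in> D" "i < length v" "a \<in> face D v" "b \<in> face D v" "a ! i \<noteq> b ! i"
    and "c \<in> face (D - {i}) a"
  shows "flip i c \<in> face (D - {i}) b"
  using assms by (auto simp: face_def nth_flip)

text \<open>
  The two halves are named by vertices \<open>a\<close> and \<open>b\<close> that the cut separates; most often these are
  prescribed ends of paths.
\<close>

lemma face_split:
  assumes "i \<in> D" "i < length v" "a \<in> face D v" "b \<in> face D v" "a ! i \<noteq> b ! i"
  shows "face D v = face (D - {i}) a \<union> face (D - {i}) b"
    and "face (D - {i}) a \<inter> face (D - {i}) b = {}"
proof -
  have "u \<in> face (D - {i}) a \<or> u \<in> face (D - {i}) b" if "u \<in> face D v" for u
  proof (cases "u ! i = a ! i")
    case True
    then show ?thesis using in_half[of i D u a] that assms face_eq by blast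
  next
    case False
    then have "u ! i = b ! i" using assms(5) by blast
    then show ?thesis using in_half[of i D u b] that assms face_eq by blast
  qed
  then show "face D v = face (D - {i}) a \<union> face (D - {i}) b"
    using half_in_face face_eq assms by blast
  show "face (D - {i}) a \<inter> face (D - {i}) b = {}"
    using assms half_nth length_face by (metis disjoint_iff)
qed

lemma face_differ:
  assumes "a \<in> face D v" "b \<in> face D v" "a \<noteq> b"
  obtains i where "i \<in> D" "i < length v" "a ! i \<noteq> b ! i"
  using assms by (auto simp: face_def list_eq_iff_nth_eq)

text \<open>
  Two prescribed ends of one colour in a half thus guarantee that the half is large enough to offer
  a choice of crossing points; this replaces separate treatment of small dimensions.
\<close>

lemma same_parity_card:
  assumes "D \<subseteq> {..<length v}" "a \<in> face D v" "b \<in> face D v" "a \<noteq> b"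
    and "odd_vertex a = odd_vertex b"
  shows "card D \<ge> 2"
proof -
  obtain i where i: "i \<in> D" "i < length v" "a ! i \<noteq> b ! i"
    using face_differ assms by metis
  have l: "length a = length v" using assms length_face by blast
  have "flip i a \<noteq> b" using i l assms by (metis odd_vertex_flip)
  then obtain j where "j \<in> D" "flip i a ! j \<noteq> b ! j" "j < length v"
    using face_differ[of "flip i a" D v b] assms i flip_in_face by metis
  with i l have "{i, j} \<subseteq> D" "i \<noteq> j" by (auto simp: nth_flip)
  then have "card {i, j} \<le> card D"
    using assms(1) finite_subset by (metis card_mono finite_lessThan)
  then show ?thesis using \<open>i \<noteq> j\<close> by simp
qed

lemma parity_vertex:
  assumes "D \<subseteq> {..<length v}" "card D \<ge> 1"
  obtains x where "x \<in> face D v" "odd_vertex x = c"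
proof -
  obtain i where "i \<in> D" using assms(2) by fastforce
  then show ?thesis
    using that[of v] that[of "flip i v"] assms(1) flip_in_face[of i D v v]
    by (cases "odd_vertex v = c") auto
qed

lemma parity_vertex_avoiding:
  assumes "D \<subseteq> {..<length v}" "card D \<ge> 2"
  obtains x where "x \<in> face D v" "odd_vertex x = c" "x \<noteq> w"
proof -
  have fin: "finite D" using assms(1) finite_subset by blast
  obtain i where i: "i \<in> D" using assms(2) by fastforce
  have c: "card (D - {i}) \<ge> 1" using assms fin i by simp
  define u where "u = (if w ! i = v ! i then flip i v else v)"
  have u: "u \<in> face D v" using i by (simp add: u_def flip_in_face)
  have sub: "D - {i} \<subseteq> {..<length u}" using assms(1) by (auto simp: u_def)
  obtain x where x: "x \<in> face (D - {i}) u" "odd_vertex x = c"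
    using parity_vertex[OF sub c] by metis
  have "x ! i \<noteq> w ! i" 
    using half_nth[OF x(1)] i assms(1) by (auto simp: u_def nth_flip subset_iff split: if_splits)
  then show ?thesis using that x u half_in_face face_eq by metis
qed

lemma parity_vertex_avoiding2:
  assumes "D \<subseteq> {..<length v}" "card D \<ge> 3"
  obtains x where "x \<in> face D v" "odd_vertex x = c" "x \<noteq> w" "x \<noteq> w'"
proof (cases "w = w'")
  case True
  then show ?thesis using parity_vertex_avoiding[of D v c w] assms that by auto
next
  case False
  have fin: "finite D" using assms(1) finite_subset by blast
  show ?thesis
  proof (cases "w \<in> face D v \<and> w' \<in> face D v")
    case True
    then obtain i where i: "i \<in> D" "i < length v" "w ! i \<noteq> w' ! i"
      using face_differ False by metis
    have c: "card (D - {i}) \<ge> 2" using assms fin i by simp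
    have "D - {i} \<subseteq> {..<length w}" using assms(1) True length_face by auto
    then obtain x where x: "x \<in> face (D - {i}) w" "odd_vertex x = c" "x \<noteq> w"
      using c parity_vertex_avoiding by metis
    have "x ! i = w ! i" using half_nth x True i length_face by metis
    then show ?thesis using that[of x] x i True half_in_face face_eq by metis
  next
    case False
    then obtain z where "\<And>x. x \<in> face D v \<Longrightarrow> x \<noteq> z \<Longrightarrow> x \<noteq> w \<and> x \<noteq> w'"
      by metis
    then show ?thesis
      using parity_vertex_avoiding[of D v c z] assms that by (metis add_leE numeral_Bit1 numeral_One one_add_one)
  qed
qed

section \<open>Coverings of faces by one or two paths\<close>

definition traversable :: "bool list set \<Rightarrow> bool list \<Rightarrow> bool list \<Rightarrow> bool" where
  "traversable S a b \<longleftrightarrow>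
     (\<exists>p. p \<noteq> [] \<and> hd p = a \<and> last p = b \<and> distinct p \<and> set p = S \<and> successively adj p)"

text \<open>
  Either path may consist of a single vertex. These degenerate coverings are what makes the
  constructions below work in low dimensions.
\<close>

definition two_paths ::
  "bool list set \<Rightarrow> bool list \<Rightarrow> bool list \<Rightarrow> bool list \<Rightarrow> bool list \<Rightarrow> bool" where
  "two_paths S a b c d \<longleftrightarrow>
     (\<exists>A B. traversable A a b \<and> traversable B c d \<and> A \<inter> B = {} \<and> S = A \<union> B)"

lemma traversable_single: "traversable {a} a a"
  unfolding traversable_def by (rule exI[of _ "[a]"]) simp

lemma traversable_join:
  assumes "traversable S a b" "adj b c" "traversable T c d" "S \<inter> T = {}"
  shows "traversable (S \<union> T) a d"
proof -
  obtain p where p: "p \<noteq> []" "hd p = a" "last p = b" "distinct p" "set p = S" "successively adj p"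
    using assms(1) traversable_def by auto
  obtain q where q: "q \<noteq> []" "hd q = c" "last q = d" "distinct q" "set q = T" "successively adj q"
    using assms(3) traversable_def by auto
  show ?thesis unfolding traversable_def
    by (rule exI[of _ "p @ q"]) (use p q assms in \<open>auto simp: successively_append_iff\<close>)
qed

lemma traversable_sym:
  assumes "traversable S a b"
  shows "traversable S b a"
proof -
  obtain p where p: "p \<noteq> []" "hd p = a" "last p = b" "distinct p" "set p = S" "successively adj p"
    using assms traversable_def by auto
  have "successively (\<lambda>x y. adj y x) p" using p(6) by (rule successively_mono) (rule adj_sym)
  then show ?thesis unfolding traversable_def
    by (intro exI[of _ "rev p"]) (use p in \<open>auto simp: hd_rev last_rev\<close>)
qed

lemma two_pathsI:
  "traversable A a b \<Longrightarrow> traversable B c d \<Longrightarrow> A \<inter> B = {} \<Longrightarrow> S = A \<union> B \<Longrightarrow> two_paths S a b c d"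
  unfolding two_paths_def by blast

lemma two_paths_swap: "two_paths S a b c d \<Longrightarrow> two_paths S c d a b"
  unfolding two_paths_def by blast

lemma two_paths_rev: "two_paths S a b c d \<Longrightarrow> two_paths S a b d c"
  unfolding two_paths_def using traversable_sym by blast

lemma two_paths_extend:
  assumes "two_paths S a b c d" "adj d e" "traversable T e f" "S \<inter> T = {}"
  shows "two_paths (S \<union> T) a b c f"
proof -
  obtain A B where AB: "traversable A a b" "traversable B c d" "A \<inter> B = {}" "S = A \<union> B"
    using assms(1) two_paths_def by auto
  have "traversable (B \<union> T) c f" using traversable_join[OF AB(2) assms(2,3)] AB assms by auto
  moreover have "A \<inter> (B \<union> T) = {}" using AB assms by auto
  ultimately have "two_paths (A \<union> (B \<union> T)) a b c f" using two_pathsI[OF AB(1)] by blast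
  then show ?thesis using AB by (simp add: Un_assoc)
qed

lemma two_paths_join:
  assumes "two_paths S a x c y" "adj x x'" "adj y y'" "two_paths T x' b y' d" "S \<inter> T = {}"
  shows "two_paths (S \<union> T) a b c d"
proof -
  obtain A B where AB: "traversable A x' b" "traversable B y' d" "A \<inter> B = {}" "T = A \<union> B"
    using assms(4) two_paths_def by auto
  have "two_paths (S \<union> B) a x c d" using two_paths_extend assms AB by blast
  then have "two_paths (S \<union> B \<union> A) c d a b"
    using two_paths_extend[of "S \<union> B" c d a x x' A b] two_paths_swap assms AB by blast
  then show ?thesis using two_paths_swap AB by (simp add: Un_ac)
qed

text \<open>
  Cut between \<open>a\<close> and \<open>b\<close>. Any \<open>c\<close> in the half of \<open>a\<close> of the parity of \<open>b\<close> is a place to cross the cut: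
  the vertex reached has the parity of \<open>a\<close>, so both halves are covered by induction. Such a \<open>c\<close> is
  missing only if the halves are single vertices, and then \<open>a\<close> itself is adjacent to \<open>b\<close>.
\<close>

theorem traversable_face:
  assumes "D \<subseteq> {..<length a}" "b \<in> face D a" "odd_vertex a \<noteq> odd_vertex b"
  shows "traversable (face D a) a b"
  using assms
proof (induction "card D" arbitrary: D a b)
  case 0
  then have "D = {}" using finite_subset[of D "{..<length a}"] by simp
  then show ?case using 0 face_differ[of a D a b] by auto
next
  case (Suc k)
  have fin: "finite D" using Suc.prems(1) finite_subset by blast
  obtain i where i: "i \<in> D" "i < length a" "a ! i \<noteq> b ! i"
    using Suc.prems face_differ[of a D a b] by auto
  have k: "card (D - {i}) = k" using Suc.hyps(2) fin i by simp
  have l: "length b = length a" using Suc.prems length_face by blast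
  note split = face_split[OF i(1,2) self_in_face Suc.prems(2) i(3)]
  show ?case
  proof (cases "k = 0")
    case True
    have "D - {i} = {}" using True k fin by (metis card_0_eq finite_Diff)
    then have h: "face (D - {i}) a = {a}" "face (D - {i}) b = {b}"
      by (simp_all only: face_empty)
    have "b = flip i a"
      using flip_in_half[OF i(1,2) self_in_face Suc.prems(2) i(3), of a] h by auto
    then show ?thesis unfolding split(1) h
      using traversable_join[OF traversable_single adj_flip[OF i(2)] traversable_single] split(2) h
      by auto
  next
    case False
    have sub: "D - {i} \<subseteq> {..<length a}" "D - {i} \<subseteq> {..<length b}" using Suc.prems l by auto
    obtain c where c: "c \<in> face (D - {i}) a" "odd_vertex c \<noteq> odd_vertex a"
      using parity_vertex[OF sub(1), of "\<not> odd_vertex a"] k False by auto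
    have lc: "length c = length a" using c length_face by blast
    have c': "flip i c \<in> face (D - {i}) b"
      using flip_in_half[OF i(1,2) self_in_face Suc.prems(2) i(3) c(1)] .
    have "traversable (face (D - {i}) a) a c"
      using Suc.hyps(1)[of "D - {i}" a c] k sub c by auto
    moreover have "traversable (face (D - {i}) b) b (flip i c)"
      using Suc.hyps(1)[of "D - {i}" b "flip i c"] k sub c c' i lc Suc.prems by auto
    ultimately show ?thesis unfolding split(1)
      using traversable_join adj_flip[of i c] i lc traversable_sym split(2) by metis
  qed
qed

lemma traversable_face_at:
  assumes "D \<subseteq> {..<length v}" "a \<in> face D v" "b \<in> face D v" "odd_vertex a \<noteq> odd_vertex b"
  shows "traversable (face D v) a b"
  using traversable_face[of D a b] assms face_eq length_face by metis

text \<open>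
  Cut between \<open>a\<close> and \<open>b\<close>, and let \<open>a\<close> be on the side of the deleted vertex. By induction this side
  without \<open>v\<close> has a Hamiltonian path from \<open>a\<close> to another vertex \<open>x\<close> of the same parity; crossing
  the cut at \<open>x\<close> leads to a vertex from which the intact half is traversed to \<open>b\<close>.
\<close>

theorem traversable_face_minus_vertex:
  assumes "D \<subseteq> {..<length v}" "a \<in> face D v" "b \<in> face D v" "a \<noteq> b"
    and "odd_vertex a \<noteq> odd_vertex v" "odd_vertex b \<noteq> odd_vertex v"
  shows "traversable (face D v - {v}) a b"
  using assms
proof (induction "card D" arbitrary: D a b)
  case 0
  then have "D = {}" using finite_subset[of D "{..<length v}"] by simp
  then show ?case using 0 face_differ[of a D v b] by auto
next
  case (Suc k)
  have fin: "finite D" using Suc.prems(1) finite_subset by blast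
  obtain i where i: "i \<in> D" "i < length v" "a ! i \<noteq> b ! i"
    using Suc.prems face_differ[of a D v b] by auto
  have k: "card (D - {i}) = k" using Suc.hyps(2) fin i by simp
  have sub: "D - {i} \<subseteq> {..<length v}" using Suc.prems by auto
  have main: "traversable (face D v - {v}) a b"
    if ab: "a \<in> face D v" "b \<in> face D v" "a ! i \<noteq> b ! i" "v ! i = a ! i"
       "odd_vertex a \<noteq> odd_vertex v" "odd_vertex b \<noteq> odd_vertex v" for a b
  proof -
    have l: "length a = length v" "length b = length v" using ab length_face by auto
    note split = face_split[OF i(1,2) ab(1,2,3)]
    have a: "a \<in> face (D - {i}) v" using in_half ab i by metis
    then have eq: "face (D - {i}) a = face (D - {i}) v" using face_eq by blast
    obtain x where x: "x \<in> face (D - {i}) v" "odd_vertex x = odd_vertex a"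
        "traversable (face (D - {i}) v - {v}) a x"
    proof (cases "card (D - {i}) \<ge> 2")
      case True
      then obtain x where "x \<in> face (D - {i}) v" "odd_vertex x = odd_vertex a" "x \<noteq> a"
        using parity_vertex_avoiding sub by metis
      then show ?thesis using that Suc.hyps(1)[of "D - {i}" a x] k sub a ab by metis
    next
      \<comment> \<open>The half is an edge, and deleting \<open>v\<close> leaves only \<open>a\<close>, so the path cannot move away from it.\<close>
      case False
      have "face (D - {i}) v \<subseteq> {v, a}"
      proof
        fix u assume u: "u \<in> face (D - {i}) v"
        show "u \<in> {v, a}"
          using same_parity_card[OF sub u a] same_parity_card[OF sub u self_in_face] False ab by auto
      qed
      then have "face (D - {i}) v - {v} = {a}" using a ab by auto
      then show ?thesis using that[of a] a traversable_single by auto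
    qed
    have lx: "length x = length v" using x length_face by blast
    have x': "flip i x \<in> face (D - {i}) b"
      using flip_in_half[OF i(1,2) ab(1,2,3)] x eq by blast
    have "traversable (face (D - {i}) b) (flip i x) b"
      using traversable_face_at[OF _ x' self_in_face] sub l x i lx ab by auto
    then have "traversable ((face (D - {i}) v - {v}) \<union> face (D - {i}) b) a b"
      using traversable_join[OF x(3) adj_flip[of i x]] split(2) i lx eq by auto
    moreover have "v \<notin> face (D - {i}) b" using split(2) eq by auto
    ultimately show ?thesis using split(1) eq by (simp add: Un_Diff)
  qed
  show ?case
  proof (cases "v ! i = a ! i")
    case True
    then show ?thesis using main[of a b] Suc.prems i by blast
  next
    case False
    then show ?thesis using main[of b a] Suc.prems i traversable_sym by blast
  qed
qed

lemma traversable_face_minus: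
  assumes "D \<subseteq> {..<length v}" "u \<in> face D v" "a \<in> face D v" "b \<in> face D v" "a \<noteq> b"
    and "odd_vertex a \<noteq> odd_vertex u" "odd_vertex b \<noteq> odd_vertex u"
  shows "traversable (face D v - {u}) a b"
  using traversable_face_minus_vertex[of D u a b] assms face_eq length_face by metis

text \<open>
  Orient the paths so that \<open>a\<close> and \<open>c\<close> have one parity and \<open>b\<close> and \<open>d\<close> the other, and cut between \<open>a\<close> and
  \<open>d\<close>. The point of this choice is that it rules out the one awkward distribution of the ends, with
  \<open>a\<close>, \<open>d\<close> in one half and \<open>b\<close>, \<open>c\<close> in the other. There both paths would have to cross the cut, and
  the vertices reached could coincide with prescribed ends. In the remaining distributions the
  parities alone keep the crossing points away from all ends of the half that is entered.
\<close>

theorem two_neutral_paths_face: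
  assumes "D \<subseteq> {..<length v}" "{a, b, c, d} \<subseteq> face D v" "distinct [a, b, c, d]"
    and "odd_vertex a \<noteq> odd_vertex b" "odd_vertex c \<noteq> odd_vertex d"
  shows "two_paths (face D v) a b c d"
  using assms
proof (induction "card D" arbitrary: D v a b c d)
  case 0
  then have "D = {}" using finite_subset[of D "{..<length v}"] by simp
  then show ?case using 0 by simp
next
  case (Suc k)
  have fin: "finite D" using Suc.prems(1) finite_subset by blast
  have main: "two_paths (face D v) a b c d"
    if abcd: "{a, b, c, d} \<subseteq> face D v" "distinct [a, b, c, d]"
      "odd_vertex a = odd_vertex c" "odd_vertex b = odd_vertex d" "odd_vertex a \<noteq> odd_vertex d"
    for a b c d
  proof -
    have inf: "a \<in> face D v" "b \<in> face D v" "c \<in> face D v" "d \<in> face D v"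
      using abcd(1) by auto
    obtain i where i: "i \<in> D" "i < length v" "a ! i \<noteq> d ! i"
      using abcd inf face_differ[of a D v d] by auto
    have k: "card (D - {i}) = k" using Suc.hyps(2) fin i by simp
    have l: "length a = length v" "length d = length v" using inf length_face by auto
    have sub: "D - {i} \<subseteq> {..<length a}" "D - {i} \<subseteq> {..<length d}" using Suc.prems(1) l by auto
    define A where "A = face (D - {i}) a"
    define B where "B = face (D - {i}) d"
    have split: "face D v = A \<union> B" "A \<inter> B = {}"
      using face_split[OF i(1,2) inf(1,4) i(3)] A_def B_def by auto
    have aA: "a \<in> A" and dB: "d \<in> B" by (auto simp: A_def B_def)
    have AB: "flip i x \<in> B" "adj x (flip i x)" "odd_vertex (flip i x) \<noteq> odd_vertex x" if "x \<in> A" for x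
      using flip_in_half[OF i(1,2) inf(1,4) i(3), of x] adj_flip[of i x] i l that length_face
      by (auto simp: A_def B_def)
    have BA: "flip i x \<in> A" "adj x (flip i x)" "odd_vertex (flip i x) \<noteq> odd_vertex x" if "x \<in> B" for x
      using flip_in_half[OF i(1,2) inf(4,1) i(3)[symmetric], of x] adj_flip[of i x] i l that length_face
      by (auto simp: A_def B_def)
    have hamA: "traversable A x y" if "x \<in> A" "y \<in> A" "odd_vertex x \<noteq> odd_vertex y" for x y
      using traversable_face_at sub that unfolding A_def by blast
    have hamB: "traversable B x y" if "x \<in> B" "y \<in> B" "odd_vertex x \<noteq> odd_vertex y" for x y
      using traversable_face_at sub that unfolding B_def by blast
    have twoA: "two_paths A x y z w"
      if "{x, y, z, w} \<subseteq> A" "distinct [x, y, z, w]" "odd_vertex x \<noteq> odd_vertex y" "odd_vertex z \<noteq> odd_vertex w"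
      for x y z w using Suc.hyps(1)[of "D - {i}" a x y z w] that k sub unfolding A_def by blast
    have twoB: "two_paths B x y z w"
      if "{x, y, z, w} \<subseteq> B" "distinct [x, y, z, w]" "odd_vertex x \<noteq> odd_vertex y" "odd_vertex z \<noteq> odd_vertex w"
      for x y z w using Suc.hyps(1)[of "D - {i}" d x y z w] that k sub unfolding B_def by blast
    have avA: "\<exists>x\<in>A. odd_vertex x = p \<and> x \<noteq> w" if "card (D - {i}) \<ge> 2" for p w
      using parity_vertex_avoiding[OF sub(1) that] unfolding A_def by metis
    have avB: "\<exists>x\<in>B. odd_vertex x = p \<and> x \<noteq> w" if "card (D - {i}) \<ge> 2" for p w
      using parity_vertex_avoiding[OF sub(2) that] unfolding B_def by metis
    have cardA: "card (D - {i}) \<ge> 2" if "x \<in> A" "y \<in> A" "x \<noteq> y" "odd_vertex x = odd_vertex y" for x y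
      using same_parity_card[OF sub(1)] that unfolding A_def by blast
    have cardB: "card (D - {i}) \<ge> 2" if "x \<in> B" "y \<in> B" "x \<noteq> y" "odd_vertex x = odd_vertex y" for x y
      using same_parity_card[OF sub(2)] that unfolding B_def by blast
    consider "b \<in> A" "c \<in> B" | "b \<in> A" "c \<in> A" | "b \<in> B" "c \<in> B" | "b \<in> B" "c \<in> A"
      using inf split by auto
    then show ?thesis
    proof cases
      \<comment> \<open>Each pair has a half to itself.\<close>
      case 1
      then show ?thesis using two_pathsI[OF hamA hamB] aA dB abcd split by auto
    next
      \<comment> \<open>Only \<open>d\<close> is cut off: the path from \<open>c\<close> leaves at \<open>x\<close> and traverses the half of \<open>d\<close>.\<close>
      case 2
      have "card (D - {i}) \<ge> 2" using cardA[of a c] 2 aA abcd by auto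
      then obtain x where x: "x \<in> A" "odd_vertex x = odd_vertex d" "x \<noteq> b" using avA by blast
      have "two_paths A a b c x" using twoA x 2 aA abcd by auto
      moreover have "traversable B (flip i x) d" using hamB AB[OF x(1)] x dB by auto
      ultimately show ?thesis using two_paths_extend AB[OF x(1)] split by metis
    next
      \<comment> \<open>The mirror image of the previous case, with \<open>a\<close> cut off.\<close>
      case 3
      have "card (D - {i}) \<ge> 2" using cardB[of b d] 3 dB abcd by auto
      then obtain x where x: "x \<in> B" "odd_vertex x = odd_vertex a" "x \<noteq> c" using avB by blast
      have "two_paths B c d b x" using twoB x 3 dB abcd by auto
      moreover have "traversable A (flip i x) a" using hamA BA[OF x(1)] x aA by auto
      ultimately have "two_paths (B \<union> A) c d b a" using two_paths_extend BA[OF x(1)] split by blast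
      then show ?thesis using two_paths_swap two_paths_rev split by (metis sup_commute)
    next
      \<comment> \<open>The cut separates the two parities. Both paths cross it, and they enter the half of \<open>b\<close> and \<open>d\<close>
          at vertices of the other parity.\<close>
      case 4
      have "card (D - {i}) \<ge> 2" using cardA[of a c] 4 aA abcd by auto
      then obtain x y where x: "x \<in> A" "odd_vertex x = odd_vertex d"
          and y: "y \<in> A" "odd_vertex y = odd_vertex d" "y \<noteq> x"
        using avA by metis
      have "two_paths A a x c y" using twoA x y 4 aA abcd by auto
      moreover have "flip i x \<noteq> flip i y" using y(3) by (metis flip_flip)
      then have "two_paths B (flip i x) b (flip i y) d"
        using twoB[of "flip i x" b "flip i y" d] AB[OF x(1)] AB[OF y(1)] x y 4 dB abcd
        by auto
      ultimately show ?thesis using two_paths_join AB[OF x(1)] AB[OF y(1)] split by metis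
    qed
  qed
  show ?case
  proof (cases "odd_vertex a = odd_vertex c")
    case True
    then show ?thesis using main[of a b c d] Suc.prems by auto
  next
    case False
    then have "two_paths (face D v) a b d c" using main[of a b d c] Suc.prems by auto
    then show ?thesis by (rule two_paths_rev)
  qed
qed

text \<open>
  In \<open>two_charged_paths_face\<close> this serves the tightest position, where both paths must move away from
  their starting points before they may cross the cut.

  Cut along an arbitrary coordinate. If \<open>a\<close> and \<open>c\<close> are in the same half, one path goes around \<open>c\<close> in
  this half, and the other steps from \<open>c\<close> directly into the other half and traverses it. If they are
  separated, the path from \<open>a\<close> traverses its half and takes one vertex \<open>x\<close> of the other half, which the
  path from \<open>c\<close> then traverses without \<open>x\<close>.
\<close>

lemma two_charged_paths_some_ends:
  assumes "D \<subseteq> {..<length v}" "card D \<ge> 3" "a \<in> face D v" "c \<in> face D v"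
    and "odd_vertex a \<noteq> odd_vertex c"
  obtains x y where "x \<in> face D v" "y \<in> face D v" "odd_vertex x = odd_vertex a"
    "odd_vertex y = odd_vertex c" "x \<noteq> a" "y \<noteq> c" "two_paths (face D v) a x c y"
proof -
  have fin: "finite D" using assms(1) finite_subset by blast
  obtain i where i: "i \<in> D" "i < length v" using assms(1,2) by (cases "D = {}") auto
  have k: "card (D - {i}) \<ge> 2" using assms fin i by simp
  have l: "length a = length v" "length c = length v" using assms length_face by auto
  have sub: "D - {i} \<subseteq> {..<length a}" using assms(1) l by auto
  define b where "b = flip i a"
  have b: "b \<in> face D v" "a ! i \<noteq> b ! i" "length b = length v"
    using flip_in_face i assms l by (auto simp: b_def nth_flip)
  have subb: "D - {i} \<subseteq> {..<length b}" using assms(1) b by auto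
  note split = face_split[OF i assms(3) b(1,2)]
  note half = flip_in_half[OF i assms(3) b(1,2)]
  have incl: "x \<in> face D v" if "x \<in> face (D - {i}) a \<union> face (D - {i}) b" for x
    using that split(1) by blast
  show ?thesis
  proof (cases "c \<in> face (D - {i}) a")
    case True
    obtain x where x: "x \<in> face (D - {i}) a" "odd_vertex x = odd_vertex a" "x \<noteq> a"
      using parity_vertex_avoiding[OF sub k] by metis
    obtain y where y: "y \<in> face (D - {i}) b" "odd_vertex y = odd_vertex c"
      using parity_vertex_avoiding[OF subb k] by metis
    have "traversable (face (D - {i}) a - {c}) a x"
      using traversable_face_minus[OF sub True self_in_face x(1)] x assms by auto
    then have "two_paths (face (D - {i}) a) a x c c"
      using two_pathsI[OF _ traversable_single[of c]] True by blast
    moreover have "traversable (face (D - {i}) b) (flip i c) y"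
      using traversable_face_at[OF subb half[OF True] y(1)] y i l by auto
    ultimately have "two_paths (face D v) a x c y"
      using two_paths_extend adj_flip[of i c] i l split by metis
    moreover have "y \<noteq> c" using True y split(2) by auto
    ultimately show ?thesis using that x y incl by blast
  next
    case False
    then have c: "c \<in> face (D - {i}) b" using split assms by blast
    obtain z where z: "z \<in> face (D - {i}) a" "odd_vertex z = odd_vertex c"
      using parity_vertex_avoiding[OF sub k] by metis
    obtain y where y: "y \<in> face (D - {i}) b" "odd_vertex y = odd_vertex c" "y \<noteq> c"
      using parity_vertex_avoiding[OF subb k] by metis
    define x where "x = flip i z"
    have lz: "length z = length v" using z l length_face by metis
    have x: "x \<in> face (D - {i}) b" "odd_vertex x = odd_vertex a" "adj z x"
      using half[OF z(1)] z assms i lz adj_flip by (auto simp: x_def)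
    have "traversable (face (D - {i}) b - {x}) c y"
      using traversable_face_minus[OF subb x(1) c y(1)] x y assms by auto
    moreover have "traversable (face (D - {i}) a \<union> {x}) a x"
    proof (rule traversable_join[OF _ x(3) traversable_single])
      show "traversable (face (D - {i}) a) a z"
        using traversable_face_at[OF sub self_in_face z(1)] z assms by auto
    qed (use x split in auto)
    ultimately have "two_paths (face D v) a x c y"
      using two_pathsI[of "face (D - {i}) a \<union> {x}" a x "face (D - {i}) b - {x}" c y "face D v"]
        x(1) split by blast
    moreover have "x \<noteq> a" using x(1) split(2) self_in_face[of a "D - {i}"] by blast
    ultimately show ?thesis using that[of x y] x y incl by blast
  qed
qed

text \<open>
  One half contains \<open>r\<close>, \<open>r1\<close> and just one of \<open>g\<close>, \<open>g1\<close>. The path from \<open>r\<close> to \<open>r1\<close> covers this half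
  except for that vertex, from which the other path steps across the cut at once.
\<close>

lemma two_charged_paths_one_end_apart:
  assumes "D \<subseteq> {..<length v}" "card D \<ge> 3" "{r, r1, g, g1} \<subseteq> face D v"
    and "odd_vertex r = odd_vertex r1" "r \<noteq> r1" "odd_vertex g = odd_vertex g1"
    and "odd_vertex r \<noteq> odd_vertex g"
    and "i \<in> D" "r ! i = r1 ! i" "g ! i \<noteq> g1 ! i"
  shows "two_paths (face D v) r r1 g g1"
proof -
  have fin: "finite D" using assms(1) finite_subset by blast
  have i: "i \<in> D" "i < length v" using assms by auto
  have k: "card (D - {i}) \<ge> 2" using assms fin i by simp
  have inf: "r \<in> face D v" "r1 \<in> face D v" "g \<in> face D v" "g1 \<in> face D v" using assms by auto
  have main: "two_paths (face D v) r r1 g g1"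
    if g: "g \<in> face D v" "g1 \<in> face D v" "g ! i \<noteq> g1 ! i" "r ! i = g ! i"
      "odd_vertex g = odd_vertex g1" "odd_vertex r \<noteq> odd_vertex g" for g g1
  proof -
    have l: "length g = length v" "length g1 = length v" using g length_face by auto
    have sub: "D - {i} \<subseteq> {..<length g}" "D - {i} \<subseteq> {..<length g1}" using assms(1) l by auto
    note split = face_split[OF i g(1,2,3)]
    have r: "r \<in> face (D - {i}) g" "r1 \<in> face (D - {i}) g"
      using in_half[OF i(1)] inf g assms face_eq by metis+
    have "traversable (face (D - {i}) g - {g}) r r1"
      using traversable_face_minus[OF sub(1) self_in_face r] assms g by auto
    then have "two_paths (face (D - {i}) g) r r1 g g"
      by (rule two_pathsI[OF _ traversable_single]) auto
    moreover have "traversable (face (D - {i}) g1) (flip i g) g1"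
      using traversable_face_at[OF sub(2) flip_in_half[OF i g(1,2,3) self_in_face] self_in_face]
        i l g by auto
    ultimately show ?thesis
      using two_paths_extend adj_flip[of i g] i l split by metis
  qed
  show ?thesis
  proof (cases "r ! i = g ! i")
    case True
    then show ?thesis using main[of g g1] inf assms by blast
  next
    case False
    then have "two_paths (face D v) r r1 g1 g" using main[of g1 g] inf assms by metis
    then show ?thesis by (rule two_paths_rev)
  qed
qed

text \<open>
  Cut between \<open>r\<close> and \<open>r1\<close>. The lower bound on the dimension is needed when the cut also separates \<open>g\<close>
  from \<open>g1\<close>: the halves then have dimension three at least, which gives the room required by
  \<open>parity_vertex_avoiding2\<close> and \<open>two_charged_paths_some_ends\<close>.
\<close>

theorem two_charged_paths_face:
  assumes "D \<subseteq> {..<length v}" "card D \<ge> 4" "{r, r1, g, g1} \<subseteq> face D v"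
    and "odd_vertex r = odd_vertex r1" "r \<noteq> r1" "odd_vertex g = odd_vertex g1" "g \<noteq> g1"
    and "odd_vertex r \<noteq> odd_vertex g"
  shows "two_paths (face D v) r r1 g g1"
proof -
  have fin: "finite D" using assms(1) finite_subset by blast
  have inf: "r \<in> face D v" "r1 \<in> face D v" "g \<in> face D v" "g1 \<in> face D v" using assms by auto
  obtain i where i: "i \<in> D" "i < length v" "r ! i \<noteq> r1 ! i"
    using inf assms face_differ[of r D v r1] by auto
  have k: "card (D - {i}) \<ge> 3" using assms fin i by simp
  have l: "length r = length v" "length r1 = length v" using inf length_face by auto
  have sub: "D - {i} \<subseteq> {..<length r}" "D - {i} \<subseteq> {..<length r1}" using assms(1) l by auto
  define A where "A = face (D - {i}) r"
  define B where "B = face (D - {i}) r1"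
  have split: "face D v = A \<union> B" "A \<inter> B = {}"
    using face_split[OF i(1,2) inf(1,2) i(3)] A_def B_def by auto
  have AB: "flip i x \<in> B" "adj x (flip i x)" "odd_vertex (flip i x) \<noteq> odd_vertex x" if "x \<in> A" for x
    using flip_in_half[OF i(1,2) inf(1,2) i(3), of x] adj_flip[of i x] i l that length_face
    by (auto simp: A_def B_def)
  have rA: "r \<in> A" "r1 \<in> B" by (auto simp: A_def B_def)
  have main: "two_paths (face D v) r r1 g g1"
    if g: "g \<in> A" "g1 \<in> B" "odd_vertex g = odd_vertex g1" "odd_vertex r \<noteq> odd_vertex g" for g g1
  proof -
    \<comment> \<open>Crossing points \<open>x\<close> and \<open>y\<close> such that no path lands on the end of the other. If \<open>g\<close> is not opposite
        to \<open>r1\<close>, it can itself be the crossing point \<open>y\<close>, and likewise for \<open>r\<close>. If \<open>g\<close> is opposite to \<open>r1\<close>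
        and \<open>r\<close> to \<open>g1\<close>, it is enough that \<open>x\<close> and \<open>y\<close> differ from \<open>r\<close> and \<open>g\<close>.\<close>
    have "\<exists>x\<in>A. \<exists>y\<in>A. odd_vertex x = odd_vertex r \<and> odd_vertex y = odd_vertex g \<and>
        flip i x \<noteq> g1 \<and> flip i y \<noteq> r1 \<and> two_paths A r x g y"
    proof -
      consider "flip i g \<noteq> r1" | "flip i r \<noteq> g1" | "flip i g = r1" "flip i r = g1" by blast
      then show ?thesis
      proof cases
        case 1
        obtain x where x: "x \<in> A" "odd_vertex x = odd_vertex r" "x \<noteq> r" "x \<noteq> flip i g1"
          using parity_vertex_avoiding2[OF sub(1) k] unfolding A_def by metis
        have "traversable (A - {g}) r x"
          using traversable_face_minus[OF sub(1), of g r x] g x rA unfolding A_def by metis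
        then have "two_paths A r x g g"
          by (rule two_pathsI[OF _ traversable_single]) (use g in auto)
        then show ?thesis using x g 1 by (metis flip_flip)
      next
        case 2
        obtain y where y: "y \<in> A" "odd_vertex y = odd_vertex g" "y \<noteq> g" "y \<noteq> flip i r1"
          using parity_vertex_avoiding2[OF sub(1) k] unfolding A_def by metis
        have "traversable (A - {r}) g y"
          using traversable_face_minus[OF sub(1), of r g y] g y rA unfolding A_def by metis
        then have "two_paths A r r g y"
          by (rule two_pathsI[OF traversable_single]) (use rA in auto)
        then show ?thesis using y rA 2 by (metis flip_flip)
      next
        case 3
        obtain x y where "x \<in> A" "y \<in> A" "odd_vertex x = odd_vertex r" "odd_vertex y = odd_vertex g"
            "x \<noteq> r" "y \<noteq> g" "two_paths A r x g y"
          using two_charged_paths_some_ends[OF sub(1) k self_in_face] g unfolding A_def by metis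
        then show ?thesis using 3 by (metis flip_flip)
      qed
    qed
    then obtain x y where xy: "x \<in> A" "y \<in> A" "odd_vertex x = odd_vertex r"
        "odd_vertex y = odd_vertex g" "flip i x \<noteq> g1" "flip i y \<noteq> r1" "two_paths A r x g y"
      by blast
    have "flip i x \<noteq> r1" "flip i x \<noteq> flip i y" "r1 \<noteq> g1" "flip i y \<noteq> g1"
      using AB(3)[OF xy(1)] AB(3)[OF xy(2)] xy(3,4) g(3,4) assms(4) by metis+
    then have "two_paths B (flip i x) r1 (flip i y) g1"
      using two_neutral_paths_face[OF sub(2), of "flip i x" r1 "flip i y" g1]
        AB[OF xy(1)] AB[OF xy(2)] xy g rA assms(4) unfolding B_def by auto
    then show ?thesis using two_paths_join[OF xy(7)] AB xy split by metis
  qed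
  consider "g ! i = g1 ! i" | "g \<in> A" "g1 \<in> B" | "g1 \<in> A" "g \<in> B"
    using split inf half_nth[of _ D i] i l unfolding A_def B_def by (metis UnE)
  then show ?thesis
  proof cases
    case 1
    then have "two_paths (face D v) g g1 r r1"
      using two_charged_paths_one_end_apart[OF assms(1), of g g1 r r1 i] assms i by auto
    then show ?thesis by (rule two_paths_swap)
  next
    case 2
    then show ?thesis using main assms by blast
  next
    case 3
    then have "two_paths (face D v) r r1 g1 g" using main assms by metis
    then show ?thesis by (rule two_paths_rev)
  qed
qed

section \<open>Paths in the hypercube\<close>

lemma verts_hypercube:
  "verts (hypercube n) = {v. length v = n}" "pverts (hypercube n) = {v. length v = n}"
  by (simp_all add: hypercube_def)

lemma verts_hypercube_face: "length v = n \<Longrightarrow> verts (hypercube n) = face {..<n} v"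
  by (auto simp: verts_hypercube face_def)

lemma arcs_ends_hypercube:
  "arcs_ends (with_proj (hypercube n)) = {(u, v). length u = n \<and> adj u v}"
proof -
  have "length v = n \<and> (\<exists>!i. i < n \<and> u ! i \<noteq> v ! i) \<longleftrightarrow> adj u v" if u: "length u = n" for u v
  proof
    assume v: "length v = n \<and> (\<exists>!i. i < n \<and> u ! i \<noteq> v ! i)"
    then obtain i where i: "i < n" "u ! i \<noteq> v ! i" "\<And>j. j < n \<Longrightarrow> u ! j \<noteq> v ! j \<Longrightarrow> j = i"
      by blast
    have "v = flip i u"
    proof (rule nth_equalityI)
      show "v ! j = flip i u ! j" if "j < length v" for j
      proof -
        have "flip i u ! j \<longleftrightarrow> (if i = j then \<not> u ! j else u ! j)"
          using nth_flip[of j u i] that u v by metis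
        then show ?thesis using i(2) i(3)[of j] that v by metis
      qed
    qed (use u v in simp)
    then show "adj u v" using i(1) u unfolding adj_def by blast
  next
    assume "adj u v"
    then obtain i where "i < n" "v = flip i u" using u by (auto simp: adj_def)
    then show "length v = n \<and> (\<exists>!i. i < n \<and> u ! i \<noteq> v ! i)"
      using u by (auto simp: nth_flip intro!: ex1I[of _ i] split: if_splits)
  qed
  then have "parcs (hypercube n) = {(u, v). length u = n \<and> adj u v}"
    unfolding hypercube_def by (simp cong: conj_cong)
  then show ?thesis by (auto simp: arcs_ends_def arc_to_ends_def)
qed

lemma vpath_hypercube_iff:
  "vpath p (with_proj (hypercube n)) \<longleftrightarrow>
     p \<noteq> [] \<and> distinct p \<and> (\<forall>v\<in>set p. length v = n) \<and> successively adj p"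
proof -
  have "set (vwalk_arcs p) \<subseteq> {(u, v). length u = n \<and> adj u v} \<longleftrightarrow> successively adj p"
    if "\<forall>v\<in>set p. length v = n"
    using that by (induction p rule: vwalk_arcs.induct) auto
  then show ?thesis
    unfolding vpath_def vwalk_def arcs_ends_hypercube verts_hypercube by auto
qed

lemma two_paths_covering:
  assumes "two_paths (verts (hypercube n)) a b c d"
  obtains p q where "k_path_covering 2 (hypercube n) {p, q}"
    "hd p = a" "last p = b" "hd q = c" "last q = d"
proof -
  obtain A B where AB: "traversable A a b" "traversable B c d" "A \<inter> B = {}"
      "verts (hypercube n) = A \<union> B"
    using assms two_paths_def by auto
  obtain p where p: "p \<noteq> []" "hd p = a" "last p = b" "distinct p" "set p = A" "successively adj p"
    using AB(1) traversable_def by auto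
  obtain q where q: "q \<noteq> []" "hd q = c" "last q = d" "distinct q" "set q = B" "successively adj q"
    using AB(2) traversable_def by auto
  have "p \<noteq> q" using p q AB(3) by auto
  moreover have "\<forall>v\<in>A \<union> B. length v = n" using AB(4) verts_hypercube by auto
  ultimately have "k_path_covering 2 (hypercube n) {p, q}"
    unfolding k_path_covering_def path_covering_def
    using p q AB by (auto simp: vpath_hypercube_iff)
  then show ?thesis using that p q by blast
qed

lemma faulty_hypercube_empty:
  "verts (faulty_hypercube n {}) = verts (hypercube n)"
  "arcs_ends (faulty_hypercube n {}) = arcs_ends (with_proj (hypercube n))"
  by (auto simp: faulty_hypercube_def arcs_ends_def arc_to_ends_def hypercube_def)

lemma path_covering_faultless:
  "path_covering (faulty_hypercube n {}) P \<longleftrightarrow> path_covering (hypercube n) P"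
  by (simp add: path_covering_def vpath_def vwalk_def faulty_hypercube_empty)

section \<open>Pairs of ends in balance with the empty fault\<close>

lemma neutral_or_charged:
  assumes "card e = 2"
  shows "neutral_pair c e \<or> charged_pair c e"
  by (auto simp: neutral_pair_def charged_pair_def red_pair_def green_pair_def)

text \<open>
  Without deleted vertices the red and green pairs are equally many, so two charged pairs are one
  red and one green pair.
\<close>

lemma balanced_pair_sets_two_charged:
  assumes "E \<in> balanced_pair_sets c n {} 0 2"
  obtains r r1 g g1 where "E = {{r, r1}, {g, g1}}" "{r, r1, g, g1} \<subseteq> verts (hypercube n)"
    "red c r" "red c r1" "r \<noteq> r1" "green c g" "green c g1" "g \<noteq> g1"
proof -
  let ?R = "{e \<in> E. red_pair c e}" and ?G = "{e \<in> E. green_pair c e}"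
  have E: "disjoint_pairs E" "\<Union>E \<subseteq> verts (hypercube n)" "card ?G = card ?R"
      "card {e \<in> E. neutral_pair c e} = 0" "card {e \<in> E. charged_pair c e} = 2"
    using assms
    by (auto simp: balanced_pair_sets_def in_balance_def faulty_hypercube_empty vertex_excess_def)
  have two: "card e = 2" if "e \<in> E" for e using E(1) that by (auto simp: disjoint_pairs_def)
  have "finite (verts (hypercube n))"
    using finite_lists_length_eq[of "UNIV :: bool set" n] by (simp add: verts_hypercube)
  then have fin: "finite E" using E(2) by (meson finite_UnionD finite_subset)
  then have noneutral: "{e \<in> E. neutral_pair c e} = {}" using E(4) by simp
  have EU: "E = ?R \<union> ?G"
    using noneutral neutral_or_charged two by (auto simp: charged_pair_def)
  have "?R \<inter> ?G = {}"
  proof -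
    have False if "e \<in> ?R \<inter> ?G" for e
    proof -
      have "e \<noteq> {}" using two[of e] that by auto
      then show False using that by (auto simp: red_pair_def green_pair_def)
    qed
    then show ?thesis by blast
  qed
  moreover have "{e \<in> E. charged_pair c e} = ?R \<union> ?G" by (auto simp: charged_pair_def)
  then have "card (?R \<union> ?G) = 2" using E(5) by simp
  ultimately have "card ?R + card ?G = 2" using fin by (subst card_Un_disjoint[symmetric]) auto
  then have "card ?R = 1" "card ?G = 1" using E(3) by auto
  then obtain a b where ab: "?R = {a}" "?G = {b}" by (metis card_1_singletonE)
  then have "a \<in> ?R" "b \<in> ?G" by auto
  then have ab': "a \<in> E" "b \<in> E" "red_pair c a" "green_pair c b" by auto
  obtain r r1 where r: "a = {r, r1}" "r \<noteq> r1" using two ab' by (metis card_2_iff)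
  obtain g g1 where g: "b = {g, g1}" "g \<noteq> g1" using two ab' by (metis card_2_iff)
  show ?thesis
  proof (rule that[of r r1 g g1])
    show "E = {{r, r1}, {g, g1}}" using EU ab r g by auto
    show "{r, r1, g, g1} \<subseteq> verts (hypercube n)" using E(2) ab' r g by auto
  qed (use ab' r g in \<open>auto simp: red_pair_def green_pair_def\<close>)
qed

lemma two_charged_in_balanced_pair_sets:
  assumes "{r, r1, g, g1} \<subseteq> verts (hypercube n)"
    and "red c r" "red c r1" "r \<noteq> r1" "green c g" "green c g1" "g \<noteq> g1"
  shows "{{r, r1}, {g, g1}} \<in> balanced_pair_sets c n {} 0 2"
proof -
  let ?E = "{{r, r1}, {g, g1}}"
  have ne: "{r, r1} \<noteq> {g, g1}" using assms by (auto simp: doubleton_eq_iff)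
  have "{e \<in> ?E. green_pair c e} = {{g, g1}}" "{e \<in> ?E. red_pair c e} = {{r, r1}}"
    using assms by (auto simp: green_pair_def red_pair_def)
  moreover have "{e \<in> ?E. neutral_pair c e} = {}" "{e \<in> ?E. charged_pair c e} = ?E"
    using assms by (auto simp: neutral_pair_def charged_pair_def green_pair_def red_pair_def)
  moreover have "disjoint_pairs ?E" using assms by (auto simp: disjoint_pairs_def)
  ultimately show ?thesis
    using assms ne
    by (simp add: balanced_pair_sets_def in_balance_def vertex_excess_def faulty_hypercube_empty)
qed

section \<open>The obstruction in dimension three\<close>

lemma successively_crossing:
  assumes "successively R p" "p \<noteq> []" "hd p \<in> S" "last p \<notin> S"
  shows "\<exists>u\<in>set p \<inter> S. \<exists>v\<in>set p - S. R u v"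
  using assms by (induction p rule: induct_list012) (auto split: if_splits)

text \<open>
  The ends of a path are known only as a set, hence the symmetric treatment of its direction.
\<close>

lemma path_crossing:
  assumes "vpath p (with_proj (hypercube n))" "{hd p, last p} = {a, b}" "a \<in> S" "b \<notin> S"
  shows "\<exists>u\<in>set p \<inter> S. \<exists>v\<in>set p - S. adj u v"
proof -
  have p: "p \<noteq> []" "successively adj p" using assms(1) by (auto simp: vpath_hypercube_iff)
  consider "hd p = a" "last p = b" | "hd p = b" "last p = a"
    using assms(2) by (auto simp: doubleton_eq_iff)
  then show ?thesis
  proof cases
    case 1
    then show ?thesis using successively_crossing p assms by metis
  next
    case 2
    then show ?thesis using successively_crossing[OF p(2,1), of "- S"] adj_sym assms by blast
  qed
qed

lemma adj_three: "adj [a, b, c] v \<longleftrightarrow> v \<in> {[\<not> a, b, c], [a, \<not> b, c], [a, b, \<not> c]}"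
  by (simp add: adj_def flip_def Ex_less_Suc disj_ac)

text \<open>
  Prescribe the diagonals \<open>a\<close>, \<open>b\<close> and \<open>x\<close>, \<open>y\<close> of the square in which the last coordinate is
  \<open>False\<close>. The path between \<open>x\<close> and \<open>y\<close> must leave each of them towards the other square, since the
  other neighbours \<open>a\<close> and \<open>b\<close> are taken. But then the path that starts at \<open>a\<close> can reach only the
  vertex above \<open>a\<close>, all of whose other neighbours are occupied.
\<close>

lemma not_freely_prescribable_three: "\<not> freely_prescribable c 3 {} 0 2"
proof
  assume free: "freely_prescribable c 3 {} 0 2"
  let ?a = "[False, False, False]" and ?b = "[True, True, False]"
    and ?x = "[True, False, False]" and ?y = "[False, True, False]"
  let ?E = "{{?a, ?b}, {?x, ?y}}"
  have "?E \<in> balanced_pair_sets c 3 {} 0 2"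
  \<comment> \<open>Which diagonal is the red one depends on the choice of colours.\<close>
  proof (cases c)
    case True
    have "{{?x, ?y}, {?a, ?b}} \<in> balanced_pair_sets c 3 {} 0 2"
      by (rule two_charged_in_balanced_pair_sets) (auto simp: verts_hypercube red_def True)
    then show ?thesis by (simp add: insert_commute)
  next
    case False
    show ?thesis
      by (rule two_charged_in_balanced_pair_sets) (auto simp: verts_hypercube red_def False)
  qed
  then obtain P where P: "path_covering (hypercube 3) P" "end_pairs P = ?E"
    using free by (auto simp: freely_prescribable_def path_covering_faultless)
  have "{?a, ?b} \<in> end_pairs P" "{?x, ?y} \<in> end_pairs P" using P(2) by auto
  then obtain p q where pq: "p \<in> P" "{hd p, last p} = {?a, ?b}" "q \<in> P" "{hd q, last q} = {?x, ?y}"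
    by (auto simp: end_pairs_def)
  then have vp: "vpath p (with_proj (hypercube 3))" "vpath q (with_proj (hypercube 3))"
    using P(1) by (auto simp: path_covering_def)
  then have ne: "p \<noteq> []" "q \<noteq> []" by (auto simp: vpath_hypercube_iff)
  then have "{hd p, last p} \<subseteq> set p" "{hd q, last q} \<subseteq> set q" by auto
  then have ends: "{?a, ?b} \<subseteq> set p" "{?x, ?y} \<subseteq> set q" using pq by metis+
  have "{?a, ?b} \<noteq> {?x, ?y}" by (auto simp: doubleton_eq_iff)
  then have "p \<noteq> q" using pq by metis
  then have dis: "set p \<inter> set q = {}" using P(1) pq by (auto simp: path_covering_def)
  then have notin: "?a \<notin> set q" "?b \<notin> set q" "?x \<notin> set p" "?y \<notin> set p" using ends by auto
  have "[True, False, True] \<in> set q"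
    using path_crossing[OF vp(2) pq(4), of "{?x}"] notin by (auto simp: adj_three)
  moreover have "[False, True, True] \<in> set q"
    using path_crossing[OF vp(2), of ?y ?x "{?y}"] pq(4) notin by (auto simp: adj_three insert_commute)
  moreover have "[True, False, True] \<in> set p \<or> [False, True, True] \<in> set p"
    using path_crossing[OF vp(1) pq(2), of "{?a, [False, False, True]}"] notin
    by (auto simp: adj_three)
  ultimately show False using dis by auto
qed

theorem lemma3p9:
  fixes odd_red :: bool
  shows "(prescribable_dims odd_red 0 0 0 2 \<noteq> {} \<and> min_dim odd_red 0 0 0 2 = 4) \<and>
    (\<forall>n r r1 g g1.
       n \<ge> 3 \<and>
       {r, r1, g, g1} \<subseteq> verts (hypercube n) \<and>
       red odd_red r \<and> red odd_red r1 \<and> r \<noteq> r1 \<and>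
       green odd_red g \<and> green odd_red g1 \<and> g \<noteq> g1 \<and>
       (n \<ge> 4 \<or>
        n = 3 \<and> (\<exists>\<alpha>. subcube n 2 \<alpha> \<and> r \<in> \<alpha> \<and> r1 \<in> \<alpha> \<and> ((g \<in> \<alpha>) \<noteq> (g1 \<in> \<alpha>)))) \<longrightarrow>
       (\<exists>p q. k_path_covering 2 (hypercube n) {p, q} \<and>
              hd p = r \<and> last p = r1 \<and> hd q = g \<and> last q = g1))"
proof -
  have parity: "odd_vertex r = odd_vertex r1" "odd_vertex g = odd_vertex g1"
      "odd_vertex r \<noteq> odd_vertex g"
    if "red odd_red r" "red odd_red r1" "green odd_red g" "green odd_red g1" for r r1 g g1
    using that by (auto simp: red_def)
  have four: "\<exists>p q. k_path_covering 2 (hypercube n) {p, q} \<and>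
      hd p = r \<and> last p = r1 \<and> hd q = g \<and> last q = g1"
    if "n \<ge> 4" "{r, r1, g, g1} \<subseteq> verts (hypercube n)" "red odd_red r" "red odd_red r1" "r \<noteq> r1"
      "green odd_red g" "green odd_red g1" "g \<noteq> g1" for n r r1 g g1
  proof -
    have v: "verts (hypercube n) = face {..<n} r" "length r = n"
      using that verts_hypercube_face[of r n] by (auto simp: verts_hypercube)
    have "two_paths (face {..<n} r) r r1 g g1"
      by (rule two_charged_paths_face) (use that v parity[of r r1 g g1] in auto)
    then show ?thesis using two_paths_covering v by metis
  qed
  have three: "\<exists>p q. k_path_covering 2 (hypercube n) {p, q} \<and>
      hd p = r \<and> last p = r1 \<and> hd q = g \<and> last q = g1"
    if "n = 3" "{r, r1, g, g1} \<subseteq> verts (hypercube n)" "red odd_red r" "red odd_red r1" "r \<noteq> r1"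
      "green odd_red g" "green odd_red g1"
      and \<alpha>: "subcube n 2 \<alpha>" "r \<in> \<alpha>" "r1 \<in> \<alpha>" "(g \<in> \<alpha>) \<noteq> (g1 \<in> \<alpha>)" for n r r1 g g1 \<alpha>
  proof -
    have v: "verts (hypercube n) = face {..<n} r" "length r = n"
      using that verts_hypercube_face[of r n] by (auto simp: verts_hypercube)
    obtain D w where D: "D \<subseteq> {..<n}" "card D = 2"
        and eq: "\<alpha> = {v \<in> verts (hypercube n). \<forall>i\<in>{..<n} - D. v ! i = w ! i}"
      using \<alpha>(1) by (auto simp: subcube_def)
    \<comment> \<open>The cut along the only coordinate that is fixed on \<open>\<alpha>\<close> has \<open>\<alpha>\<close> as one of its halves.\<close>
    have "card ({..<n} - D) = 1" using D \<open>n = 3\<close> by (simp add: card_Diff_subset finite_subset)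
    then obtain i where i: "{..<n} - D = {i}" by (metis card_1_singletonE)
    then have "i \<in> {..<n}" by auto
    moreover have "r ! i = r1 ! i" "g ! i \<noteq> g1 ! i" using \<alpha>(2-4) that(2) unfolding eq i by auto
    ultimately have "two_paths (face {..<n} r) r r1 g g1"
      by (intro two_charged_paths_one_end_apart[where i = i])
        (use that(1-7) v parity[of r r1 g g1] in auto)
    then show ?thesis using two_paths_covering v by metis
  qed
  have free: "freely_prescribable odd_red n {} 0 2" if n: "n \<ge> 4" for n
    unfolding freely_prescribable_def
  proof (intro conjI ballI)
    have sub: "{..<n} \<subseteq> {..<length (replicate n False)}" and card: "card {..<n} \<ge> 2"
      using n by auto
    have face: "face {..<n} (replicate n False) = verts (hypercube n)"
      by (rule verts_hypercube_face[symmetric]) simp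
    note pick = parity_vertex_avoiding[OF sub card, unfolded face]
    obtain r where r: "r \<in> verts (hypercube n)" "odd_vertex r = odd_red"
      using pick by metis
    obtain r1 where r1: "r1 \<in> verts (hypercube n)" "odd_vertex r1 = odd_red" "r1 \<noteq> r"
      using pick by metis
    obtain g where g: "g \<in> verts (hypercube n)" "odd_vertex g = (\<not> odd_red)"
      using pick by metis
    obtain g1 where g1: "g1 \<in> verts (hypercube n)" "odd_vertex g1 = (\<not> odd_red)" "g1 \<noteq> g"
      using pick by metis
    have "{r, r1, g, g1} \<subseteq> verts (hypercube n)"
      "red odd_red r" "red odd_red r1" "r \<noteq> r1" "green odd_red g" "green odd_red g1" "g \<noteq> g1"
      using r r1 g g1 unfolding red_def by blast+
    then have "{{r, r1}, {g, g1}} \<in> balanced_pair_sets odd_red n {} 0 2"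
      by (rule two_charged_in_balanced_pair_sets)
    then show "balanced_pair_sets odd_red n {} 0 2 \<noteq> {}" by auto
  next
    fix E assume "E \<in> balanced_pair_sets odd_red n {} 0 2"
    then obtain r r1 g g1 where E: "E = {{r, r1}, {g, g1}}" "{r, r1, g, g1} \<subseteq> verts (hypercube n)"
      "red odd_red r" "red odd_red r1" "r \<noteq> r1" "green odd_red g" "green odd_red g1" "g \<noteq> g1"
      by (rule balanced_pair_sets_two_charged)
    obtain p q where "k_path_covering 2 (hypercube n) {p, q}"
        "hd p = r" "last p = r1" "hd q = g" "last q = g1"
      using four[OF n E(2-8)] by blast
    then have "path_covering (faulty_hypercube n {}) {p, q} \<and> end_pairs {p, q} = E"
      using E(1) by (simp add: k_path_covering_def path_covering_faultless end_pairs_def)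
    then show "\<exists>P. path_covering (faulty_hypercube n {}) P \<and> end_pairs P = E" by blast
  qed
  have no_fault: "F = {}" if "fault n F" "card F = 0" for n F
  proof -
    have "finite (verts (hypercube n))"
      using finite_lists_length_eq[of "UNIV :: bool set" n] by (simp add: verts_hypercube)
    then have "finite F" using that(1) finite_subset unfolding fault_def by blast
    then show ?thesis using that(2) by simp
  qed
  have mem: "4 \<in> prescribable_dims odd_red 0 0 0 2"
  proof -
    have "log 2 (4 :: real) \<le> 4"
      by (subst log_le_iff) (auto simp: powr_numeral)
    then show ?thesis using free no_fault by (auto simp: prescribable_dims_def)
  qed
  \<comment> \<open>Membership of \<open>m \<le> 3\<close> would include the claim for dimension three.\<close>
  have least: "4 \<le> m" if "m \<in> prescribable_dims odd_red 0 0 0 2" for m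
  proof (rule ccontr)
    assume "\<not> 4 \<le> m"
    then have "m \<le> 3" by simp
    moreover have "fault 3 {}" "charge odd_red {} = 0"
      by (auto simp: fault_def charge_def vertex_excess_def)
    ultimately have "freely_prescribable odd_red 3 {} 0 2"
      using that by (auto simp: prescribable_dims_def)
    then show False using not_freely_prescribable_three by blast
  qed
  have "min_dim odd_red 0 0 0 2 = 4"
    unfolding min_dim_def using mem least by (rule Least_equality)
  show ?thesis
  proof (intro conjI allI impI)
    show "prescribable_dims odd_red 0 0 0 2 \<noteq> {}" using mem by blast
    show "min_dim odd_red 0 0 0 2 = 4" by fact
  next
    fix n r r1 g g1
    assume h: "n \<ge> 3 \<and>
       {r, r1, g, g1} \<subseteq> verts (hypercube n) \<and>
       red odd_red r \<and> red odd_red r1 \<and> r \<noteq> r1 \<and>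
       green odd_red g \<and> green odd_red g1 \<and> g \<noteq> g1 \<and>
       (n \<ge> 4 \<or>
        n = 3 \<and> (\<exists>\<alpha>. subcube n 2 \<alpha> \<and> r \<in> \<alpha> \<and> r1 \<in> \<alpha> \<and> ((g \<in> \<alpha>) \<noteq> (g1 \<in> \<alpha>))))"
    then have V: "{r, r1, g, g1} \<subseteq> verts (hypercube n)" "red odd_red r" "red odd_red r1" "r \<noteq> r1"
      "green odd_red g" "green odd_red g1" "g \<noteq> g1" by blast+
    from h consider "n \<ge> 4" | \<alpha> where "n = 3" "subcube n 2 \<alpha>" "r \<in> \<alpha>" "r1 \<in> \<alpha>" "(g \<in> \<alpha>) \<noteq> (g1 \<in> \<alpha>)"
      by metis
    then show "\<exists>p q. k_path_covering 2 (hypercube n) {p, q} \<and>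
              hd p = r \<and> last p = r1 \<and> hd q = g \<and> last q = g1"
    proof cases
      case 1
      then show ?thesis by (rule four[OF _ V])
    next
      case 2
      show ?thesis by (rule three[OF 2(1) V(1-6) 2(2-5)])
    qed
  qed
qed

end
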